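(* Let $M=\mathbb{R}^4$. The Zeeman $Z$ topology on $M$ is the intersection topology between the Euclidean topology $E$ on $\mathbb{R}^4$ and the interval topology $T_{in}^{\rightarrow}$ induced by the irreflexive relation horismos $\rightarrow$. Consequently, every open set in $Z$ is the intersection $U\cap V$ of an open set $U$ in $E$ and an open set $V$ in $T_{in}^{\rightarrow}$.
   Context: Let $M=\mathbb{R}^4$ be equipped with the quadratic form $Q(x)=x_0^2-x_1^2-x_2^2-x_3^2$ for $x=(x_0,x_1,x_2,x_3)$. Cones: for $x\in M$, the time cone is $C^T(x)=\{y: y=x \text{ or } Q(y-x)>0\}$, the light cone (null cone) is $C^L(x)=\{y: Q(y-x)=0\}$, and the space cone is $C^S(x)=\{y: y=x\text{ or }Q(y-x)<0\}$. $B^E_\epsilon(x)$ denotes the open Euclidean ball of radius $\epsilon$ around $x$. Zeeman $Z$ topology: the topology on $M$ with base consisting of the sets $Z_\epsilon(x)=B^E_\epsilon(x)\cap (C^T(x)\cup C^S(x))$, $x\in M$, $\epsilon>0$ (i.e. $Z_\epsilon(x)$ is the Euclidean ball with the light cone of $x$ removed, but with $x$ itself put back). Irreflexive horismos: $x\rightarrow y$ if $y\neq x$ and $y$ lies on the future null cone of $x$, i.e. $Q(y-x)=0$ and $y_0>x_0$. Put $\mathcal{N}^+(x)=\{y\in M: x\rightarrow y\}$ and $\mathcal{N}^-(x)=\{y\in M: y\rightarrow x\}$. Interval topology $T_{in}^{\rightarrow}$: the topology on $M$ whose basic open sets are the finite intersections of sets from the two families $\{M\setminus \mathcal{N}^-(x):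 x\in M\}$ and $\{M\setminus\mathcal{N}^+(x): x\in M\}$ (i.e. these two families together form a subbase). Intersection topology: if $T_1,T_2$ are two distinct topologies on a set $X$, the intersection topology with respect to $T_1$ and $T_2$ is the topology on $X$ such that $\{U_1\cap U_2: U_1\in T_1, U_2\in T_2\}$ forms a base for it.
   Formalization: The final sentence is false for arbitrary open sets of Z (e.g. the union of two Zeeman balls at 0 and at a far point of its past null cone); proved instead: every basic open set of Z is an intersection U∩V, and every open set of Z is a union of such intersections. *)

theory Defs
  imports "HOL-Analysis.Analysis"
begin

section \<open>Minkowski space\<close>

text \<open>
  The index type of \<^typ>\<open>real ^ 4\<close> is the ring of integers modulo 4, so that \<open>0\<close>, \<open>1\<close>, \<open>2\<close>, \<open>3\<close>
  are its four distinct elements and \<open>x $ 0\<close> is the time coordinate. The norm of \<^typ>\<open>real ^ 4\<close> is the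
  Euclidean one: \<^const>\<open>ball\<close> is the open Euclidean ball and \<^const>\<open>euclidean\<close> is the topology \<open>E\<close>.
\<close>

type_synonym minkowski = "real ^ 4"

definition Q :: "minkowski \<Rightarrow> real" where
  "Q x = (x $ 0)\<^sup>2 - (x $ 1)\<^sup>2 - (x $ 2)\<^sup>2 - (x $ 3)\<^sup>2"

definition time_cone :: "minkowski \<Rightarrow> minkowski set" where
  "time_cone x = {y. y = x \<or> Q (y - x) > 0}"

definition light_cone :: "minkowski \<Rightarrow> minkowski set" where
  "light_cone x = {y. Q (y - x) = 0}"

definition space_cone :: "minkowski \<Rightarrow> minkowski set" where
  "space_cone x = {y. y = x \<or> Q (y - x) < 0}"

section \<open>The Zeeman topology\<close>

definition is_base :: "'a topology \<Rightarrow> 'a set set \<Rightarrow> bool" where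
  "is_base T B \<longleftrightarrow> openin T = arbitrary union_of (\<lambda>U. U \<in> B)"

definition Z_ball :: "minkowski \<Rightarrow> real \<Rightarrow> minkowski set" where
  "Z_ball x \<epsilon> = ball x \<epsilon> \<inter> (time_cone x \<union> space_cone x)"

definition Z_balls :: "minkowski set set" where
  "Z_balls = {Z_ball x \<epsilon> | x \<epsilon>. \<epsilon> > 0}"

definition zeeman_Z :: "minkowski topology" where
  "zeeman_Z = topology (arbitrary union_of (\<lambda>U. U \<in> Z_balls))"

lemma Z_ball_alt: "Z_ball x \<epsilon> = {y \<in> ball x \<epsilon>. y = x \<or> Q (y - x) \<noteq> 0}"
  by (auto simp: Z_ball_def time_cone_def space_cone_def)

lemma Z_ball_refine:
  assumes "y \<in> Z_ball x \<epsilon>"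
  shows "\<exists>\<delta>>0. Z_ball y \<delta> \<subseteq> Z_ball x \<epsilon>"
proof (cases "y = x")
  case True
  with assms show ?thesis
    by (intro exI[of _ \<epsilon>]) (auto simp: Z_ball_alt intro: le_less_trans[OF zero_le_dist])
next
  case False
  have "continuous_on UNIV (\<lambda>z. Q (z - x))"
    unfolding Q_def by (intro continuous_intros)
  then have "open {z. Q (z - x) \<noteq> 0}"
    by (intro open_Collect_neq) auto
  then have "open (ball x \<epsilon> \<inter> {z. Q (z - x) \<noteq> 0})" by auto
  moreover have "y \<in> ball x \<epsilon> \<inter> {z. Q (z - x) \<noteq> 0}"
    using assms False by (auto simp: Z_ball_alt)
  ultimately obtain \<delta> where "\<delta> > 0" "ball y \<delta> \<subseteq> ball x \<epsilon> \<inter> {z. Q (z - x) \<noteq> 0}"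
    by (meson openE)
  moreover from this have "Z_ball y \<delta> \<subseteq> ball y \<delta>" by (auto simp: Z_ball_alt)
  ultimately show ?thesis by (intro exI[of _ \<delta>]) (auto simp: Z_ball_alt[of x])
qed

text \<open>
  \<^const>\<open>topology\<close> is only meaningful on predicates satisfying \<^const>\<open>istopology\<close>; the next two lemmas
  show that the sets \<open>Z_ball x \<epsilon>\<close> do form a base of \<open>zeeman_Z\<close>, whose carrier is all of \<open>M\<close>.
\<close>

lemma is_base_zeeman_Z: "is_base zeeman_Z Z_balls"
proof -
  have "(arbitrary union_of (\<lambda>U. U \<in> Z_balls)) (S \<inter> T)"
    if S: "S \<in> Z_balls" and T: "T \<in> Z_balls" for S T
    unfolding arbitrary_union_of_alt
  proof
    fix y assume y: "y \<in> S \<inter> T"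
    obtain \<delta>1 where "\<delta>1 > 0" "Z_ball y \<delta>1 \<subseteq> S"
      using S y Z_ball_refine by (force simp: Z_balls_def)
    moreover obtain \<delta>2 where "\<delta>2 > 0" "Z_ball y \<delta>2 \<subseteq> T"
      using T y Z_ball_refine by (force simp: Z_balls_def)
    moreover have "Z_ball y (min \<delta>1 \<delta>2) \<subseteq> Z_ball y \<delta>1 \<inter> Z_ball y \<delta>2"
      by (auto simp: Z_ball_alt)
    moreover have "Z_ball y (min \<delta>1 \<delta>2) \<in> Z_balls"
      using \<open>\<delta>1 > 0\<close> \<open>\<delta>2 > 0\<close> unfolding Z_balls_def by (metis (mono_tags) mem_Collect_eq min_less_iff_conj)
    moreover have "y \<in> Z_ball y (min \<delta>1 \<delta>2)"
      using \<open>\<delta>1 > 0\<close> \<open>\<delta>2 > 0\<close> by (simp add: Z_ball_alt)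
    ultimately show "\<exists>U. U \<in> Z_balls \<and> y \<in> U \<and> U \<subseteq> S \<inter> T"
      by (meson Int_mono subset_trans)
  qed
  then show ?thesis
    unfolding is_base_def zeeman_Z_def by (subst topology_inverse') (auto simp: istopology_base_eq)
qed

lemma topspace_zeeman_Z: "topspace zeeman_Z = UNIV"
proof -
  have "openin zeeman_Z (Z_ball x 1)" for x
  proof -
    have "Z_ball x 1 \<in> Z_balls" by (auto simp: Z_balls_def intro: zero_less_one)
    then show ?thesis
      using is_base_zeeman_Z unfolding is_base_def openin_topology_base_unique by blast
  qed
  moreover have "x \<in> Z_ball x 1" for x by (simp add: Z_ball_alt)
  ultimately show ?thesis using openin_subset by blast
qed

section \<open>The interval topology of irreflexive horismos\<close>

definition horismos :: "minkowski \<Rightarrow> minkowski \<Rightarrow> bool" where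
  "horismos x y \<longleftrightarrow> y \<noteq> x \<and> Q (y - x) = 0 \<and> y $ 0 > x $ 0"

definition future_null :: "minkowski \<Rightarrow> minkowski set" where
  "future_null x = {y. horismos x y}"

definition past_null :: "minkowski \<Rightarrow> minkowski set" where
  "past_null x = {y. horismos y x}"

text \<open>
  \<^const>\<open>topology_generated_by\<close> takes the union of the subbase as carrier. As no point lies in its own
  null cones, this is all of \<open>M\<close>.
\<close>

definition interval_topology :: "minkowski topology" where
  "interval_topology = topology_generated_by
     ((\<lambda>x. UNIV - past_null x) ` UNIV \<union> (\<lambda>x. UNIV - future_null x) ` UNIV)"

lemma topspace_interval_topology: "topspace interval_topology = UNIV"
  by (auto simp: interval_topology_def past_null_def horismos_def)

section \<open>Intersection topologies\<close>

text \<open>A topology is determined by any of its bases, so at most one \<open>T\<close> qualifies.\<close>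

definition is_intersection_topology :: "'a topology \<Rightarrow> 'a topology \<Rightarrow> 'a topology \<Rightarrow> bool" where
  "is_intersection_topology T T1 T2 \<longleftrightarrow>
     topspace T1 = topspace T2 \<and> T1 \<noteq> T2 \<and>
     is_base T {U1 \<inter> U2 | U1 U2. openin T1 U1 \<and> openin T2 U2}"

end

theory Submission
  imports Defs
begin

text \<open>
  The relation \<open>\<rightarrow>\<close> is irreflexive, so the light cone of \<open>x\<close> is the disjoint union of \<open>{x}\<close>,
  \<open>\<N>\<^sup>+(x)\<close> and \<open>\<N>\<^sup>-(x)\<close>; hence \<open>Z_ball x \<epsilon>\<close> is the ball minus both null cones. Conversely,
  \<open>\<N>\<^sup>\<plusminus>(x)\<close> together with its apex \<open>x\<close> is Euclidean-closed, so the complement of \<open>\<N>\<^sup>\<plusminus>(x)\<close> is a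
  Euclidean neighbourhood of each of its points except \<open>x\<close>, where it contains a Zeeman ball.
\<close>

lemma Q_minus: "Q (- x) = Q x"
  by (simp add: Q_def)

text \<open>At time coordinate 0, \<open>- Q x\<close> is a sum of three squares.\<close>

lemma Q_eq_0_imp_eq_0:
  assumes "Q x = 0" "x $ 0 = 0"
  shows "x = 0"
proof -
  have "(x $ 1)\<^sup>2 + (x $ 2)\<^sup>2 + (x $ 3)\<^sup>2 = 0"
    using assms by (simp add: Q_def)
  then have "x $ 1 = 0 \<and> x $ 2 = 0 \<and> x $ 3 = 0"
    by (smt (verit) zero_le_power2 power_eq_0_iff)
  \<comment> \<open>\<open>forall_4\<close> runs over the indices 1 to 4; modulo 4, index 4 is the
    time index 0.\<close>
  moreover have "x $ 4 = x $ 0"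
    by (rule arg_cong[where f = "($) x"]) simp
  ultimately show ?thesis
    using assms(2) by (simp add: vec_eq_iff forall_4)
qed

lemma horismos_irrefl: "\<not> horismos x x"
  by (simp add: horismos_def)

text \<open>The sign of the time difference selects the case, and equal times force
  \<open>y = x\<close>; evenness of \<open>Q\<close> lets the two points be swapped.\<close>

lemma Q_diff_eq_0_iff: "Q (y - x) = 0 \<longleftrightarrow> y = x \<or> horismos x y \<or> horismos y x"
proof -
  have "Q (x - y) = Q (y - x)"
    using Q_minus[of "y - x"] by simp
  moreover have "y = x" if "Q (y - x) = 0" "y $ 0 = x $ 0"
    using that Q_eq_0_imp_eq_0[of "y - x"] by simp
  moreover have "Q 0 = 0"
    by (simp add: Q_def)
  ultimately show ?thesis
    unfolding horismos_def by (metis diff_self linorder_neq_iff)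
qed

lemma continuous_on_Q_diff: "continuous_on UNIV (\<lambda>z. Q (z - x))"
  unfolding Q_def by (intro continuous_intros)

lemma Z_ball_eq: "Z_ball x \<epsilon> = ball x \<epsilon> \<inter> ((UNIV - past_null x) \<inter> (UNIV - future_null x))"
  by (auto simp: Z_ball_alt past_null_def future_null_def Q_diff_eq_0_iff horismos_irrefl)

lemma center_in_Z_ball: "\<epsilon> > 0 \<Longrightarrow> x \<in> Z_ball x \<epsilon>"
  by (simp add: Z_ball_alt)

text \<open>By \<open>Z_ball_refine\<close>, a basic set containing \<open>x\<close> can be replaced
  by one centred at \<open>x\<close>, as in a metric space.\<close>

lemma openin_zeeman_Z_iff: "openin zeeman_Z U \<longleftrightarrow> (\<forall>x\<in>U. \<exists>\<epsilon>>0. Z_ball x \<epsilon> \<subseteq> U)"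
proof -
  have "openin zeeman_Z U \<longleftrightarrow> (\<forall>x\<in>U. \<exists>V. V \<in> Z_balls \<and> x \<in> V \<and> V \<subseteq> U)"
    using is_base_zeeman_Z unfolding is_base_def by (simp add: arbitrary_union_of_alt)
  also have "\<dots> \<longleftrightarrow> (\<forall>x\<in>U. \<exists>\<epsilon>>0. Z_ball x \<epsilon> \<subseteq> U)"
  proof (intro ball_cong refl iffI)
    fix x assume "\<exists>V. V \<in> Z_balls \<and> x \<in> V \<and> V \<subseteq> U"
    then obtain z \<epsilon> where "x \<in> Z_ball z \<epsilon>" "Z_ball z \<epsilon> \<subseteq> U"
      by (auto simp: Z_balls_def)
    then show "\<exists>\<epsilon>>0. Z_ball x \<epsilon> \<subseteq> U"
      using Z_ball_refine by (meson subset_trans)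
  next
    fix x assume "\<exists>\<epsilon>>0. Z_ball x \<epsilon> \<subseteq> U"
    then show "\<exists>V. V \<in> Z_balls \<and> x \<in> V \<and> V \<subseteq> U"
      using center_in_Z_ball unfolding Z_balls_def by blast
  qed
  finally show ?thesis .
qed

lemma openin_zeeman_Z_open:
  assumes "open U"
  shows "openin zeeman_Z U"
  unfolding openin_zeeman_Z_iff
proof
  fix x assume "x \<in> U"
  then obtain \<epsilon> where "\<epsilon> > 0" "ball x \<epsilon> \<subseteq> U"
    using assms openE by blast
  then show "\<exists>\<epsilon>>0. Z_ball x \<epsilon> \<subseteq> U"
    by (intro exI[of _ \<epsilon>]) (auto simp: Z_ball_eq)
qed

text \<open>Adding the apex weakens the strict time inequality to \<le>, leaving an intersection of
  two closed conditions.\<close>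

lemma closed_insert_past_null: "closed (insert x (past_null x))"
proof -
  have "insert x (past_null x) = {y. Q (y - x) = 0} \<inter> {y. y $ 0 \<le> x $ 0}"
    unfolding Q_diff_eq_0_iff by (auto simp: past_null_def horismos_def)
  then show ?thesis
    by (auto intro!: closed_Int closed_Collect_eq closed_Collect_le continuous_on_Q_diff
        continuous_intros)
qed

lemma closed_insert_future_null: "closed (insert x (future_null x))"
proof -
  have "insert x (future_null x) = {y. Q (y - x) = 0} \<inter> {y. x $ 0 \<le> y $ 0}"
    unfolding Q_diff_eq_0_iff by (auto simp: future_null_def horismos_def)
  then show ?thesis
    by (auto intro!: closed_Int closed_Collect_eq closed_Collect_le continuous_on_Q_diff
        continuous_intros)
qed

lemma openin_zeeman_Z_Compl:
  assumes "closed (insert x S)" "S \<subseteq> past_null x \<union> future_null x"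
  shows "openin zeeman_Z (UNIV - S)"
proof -
  have "openin zeeman_Z (- insert x S)"
    using assms(1) by (intro openin_zeeman_Z_open) (rule open_Compl)
  moreover have "openin zeeman_Z (Z_ball x 1)"
    using Z_ball_refine by (simp add: openin_zeeman_Z_iff)
  ultimately have "openin zeeman_Z (- insert x S \<union> Z_ball x 1)"
    by (rule openin_Un)
  \<comment> \<open>The ball puts back the apex and, missing both null cones of \<open>x\<close>,
    adds no point of \<open>S\<close>. Any positive radius would do.\<close>
  moreover have "- insert x S \<union> Z_ball x 1 = UNIV - S"
    using assms(2) center_in_Z_ball[of 1 x] by (auto simp: Z_ball_eq)
  ultimately show ?thesis by simp
qed

text \<open>A generated topology is the coarsest one containing its subbase, so only complements of
  single null cones need checking.\<close>

lemma openin_zeeman_Z_interval: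
  assumes "openin interval_topology V"
  shows "openin zeeman_Z V"
proof -
  let ?\<S> = "range (\<lambda>x. UNIV - past_null x) \<union> range (\<lambda>x. UNIV - future_null x)"
  have "openin zeeman_Z S" if "S \<in> ?\<S>" for S
    using that openin_zeeman_Z_Compl closed_insert_past_null closed_insert_future_null by auto
  moreover have "generate_topology_on ?\<S> V"
    using assms by (simp add: interval_topology_def openin_topology_generated_by_iff)
  ultimately show ?thesis
    by (rule generate_topology_on_coarsest[OF istopology_openin])
qed

lemma openin_interval_Compl_null:
  "openin interval_topology (UNIV - past_null x)"
  "openin interval_topology (UNIV - future_null x)"
  unfolding interval_topology_def by (auto intro!: topology_generated_by_Basis)

lemma Z_ball_eq_Int_open:
  "\<exists>U V. openin euclidean U \<and> openin interval_topology V \<and> Z_ball x \<epsilon> = U \<inter> V"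
  unfolding Z_ball_eq
  by (rule exI[of _ "ball x \<epsilon>"],
      rule exI[of _ "(UNIV - past_null x) \<inter> (UNIV - future_null x)"])
    (simp add: openin_interval_Compl_null openin_Int)

text \<open>The origin lies outside its own future null cone but is a Euclidean limit of points of
  it.\<close>

lemma euclidean_neq_interval_topology: "euclidean \<noteq> interval_topology"
proof
  assume "euclidean = interval_topology"
  then have "open (UNIV - future_null 0)"
    using openin_interval_Compl_null(2) by (metis open_openin)
  then obtain \<epsilon> where "\<epsilon> > 0" and \<epsilon>: "ball 0 \<epsilon> \<subseteq> UNIV - future_null 0"
    by (rule openE[of _ 0]) (auto simp: future_null_def horismos_def)
  \<comment> \<open>\<open>v\<close> is a future-pointing null vector; the factor \<open>t\<close>
    scales it to norm \<open>\<epsilon> / 2\<close>.\<close>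
  define v :: minkowski where "v = axis 0 1 + axis 1 1"
  define t where "t = \<epsilon> / (2 * norm v)"
  have v: "v $ 0 = 1" "v $ 1 = 1" "v $ 2 = 0" "v $ 3 = 0"
    by (simp_all add: v_def axis_def)
  then have "norm v > 0" by auto
  with \<open>\<epsilon> > 0\<close> have "t > 0" and norm: "norm (t *\<^sub>R v) < \<epsilon>"
    by (simp_all add: t_def)
  from \<open>t > 0\<close> have "t *\<^sub>R v \<in> future_null 0"
    using v by (auto simp: future_null_def horismos_def Q_def)
  moreover have "t *\<^sub>R v \<in> ball 0 \<epsilon>"
    using norm by (simp only: mem_ball_0)
  ultimately show False
    using \<epsilon> by blast
qed

lemma is_intersection_topology_zeeman_Z:
  "is_intersection_topology zeeman_Z euclidean interval_topology"
  unfolding is_intersection_topology_def is_base_def openin_topology_base_unique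
proof (intro conjI allI impI)
  fix W assume "W \<in> {U1 \<inter> U2 | U1 U2. openin euclidean U1 \<and> openin interval_topology U2}"
  then show "openin zeeman_Z W"
    using openin_zeeman_Z_open openin_zeeman_Z_interval by (auto intro!: openin_Int)
next
  \<comment> \<open>A small Zeeman ball at \<open>x\<close> is itself an intersection of the
    required kind.\<close>
  fix W x assume "openin zeeman_Z W \<and> x \<in> W"
  then obtain \<epsilon> where "\<epsilon> > 0" "Z_ball x \<epsilon> \<subseteq> W"
    by (auto simp: openin_zeeman_Z_iff)
  then show "\<exists>V. V \<in> {U1 \<inter> U2 | U1 U2. openin euclidean U1 \<and> openin interval_topology U2}
      \<and> x \<in> V \<and> V \<subseteq> W"
    using Z_ball_eq_Int_open[of x \<epsilon>] center_in_Z_ball[of \<epsilon> x]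
    by (intro exI[of _ "Z_ball x \<epsilon>"]) blast
qed (simp_all add: topspace_interval_topology euclidean_neq_interval_topology)

text \<open>Having a base of intersections makes a general open set a union of sets
  \<open>U \<inter> V\<close>; a single such intersection is asserted for the basic sets
  \<open>Z_balls\<close>.\<close>

theorem theorem3p2:
  shows "is_intersection_topology zeeman_Z euclidean interval_topology \<and>
    (\<forall>W \<in> Z_balls. \<exists>U V. openin euclidean U \<and> openin interval_topology V \<and> W = U \<inter> V) \<and>
    (\<forall>W. openin zeeman_Z W \<longrightarrow>
      (\<exists>\<F>. W = \<Union>\<F> \<and>
        (\<forall>S \<in> \<F>. \<exists>U V. openin euclidean U \<and> openin interval_topology V \<and> S = U \<inter> V)))"
proof (intro conjI ballI allI impI)
  fix W assume "W \<in> Z_balls"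
  then show "\<exists>U V. openin euclidean U \<and> openin interval_topology V \<and> W = U \<inter> V"
    using Z_ball_eq_Int_open by (auto simp: Z_balls_def)
next
  fix W assume "openin zeeman_Z W"
  then obtain \<F> where "\<F> \<subseteq> Z_balls" "W = \<Union>\<F>"
    using is_base_zeeman_Z by (auto simp: is_base_def union_of_def)
  moreover have "\<exists>U V. openin euclidean U \<and> openin interval_topology V \<and> S = U \<inter> V"
    if "S \<in> Z_balls" for S
    using that Z_ball_eq_Int_open by (auto simp: Z_balls_def)
  ultimately show "\<exists>\<F>. W = \<Union>\<F> \<and>
      (\<forall>S \<in> \<F>. \<exists>U V. openin euclidean U \<and> openin interval_topology V \<and> S = U \<inter> V)"
    by (intro exI[of _ \<F>] conjI ballI) (simp_all add: subset_iff)
qed (rule is_intersection_topology_zeeman_Z)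

end
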